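(* For $\alpha>0$, define the integer $N=\lfloor\alpha\log(1/\varepsilon)\rfloor$. Then we have $$\sup_{f\in W^{r}_{2}}\mathbb{E}_f\|\hat f_N-f\|^2\le C[\log(1/\varepsilon)]^{-2r},$$ where $C$ is an absolute positive constant, $\lfloor\cdot\rfloor$ denotes the floor function, $W^r_2=\{f\in L^2[-1,1]:\sum_k k^{2r}|\theta_k|^2<\infty\}$ with $\theta_k=\int_{-1}^1 f(x)P_k(x)\,dx$, and $\hat f_N$ is the Legendre series estimator $\hat f_N(x)=\sum_{k=0}^{N}\sum_{j=0}^{k}\beta_{k,j}\,y_j\,P_k(x)$ built from the noisy moment observations $y_j=\int_{-1}^1x^jf(x)\,dx+\varepsilon\xi_j$, $j=0,1,\dots$
   Context: The unknown function $f$ is supported on $[-1,1]$ and is observed through its noisy moments $y_k=\mu_k+\varepsilon\xi_k$, $k=0,1,\dots$, where $\mu_k=\int_{-1}^1x^kf(x)\,dx$, $\varepsilon$ is the noise level (a small positive parameter supposed to tend to $0$), and the $\xi_k$ are i.i.d. standard Gaussian random variables. $P_k(x)=\sum_{j=0}^{k}\beta_{k,j}x^j$ denotes the normalized Legendre polynomial of degree $k$ on $[-1,1]$ (these form a complete orthonormal system in $L^2[-1,1]$), and $\beta_{k,j}$ are its coefficients. The number $r$ is the smoothness index of the Sobolev space $W^r_2$, and $\theta_k$ is the $k$-th Legendre-Fourier coefficient of $f$. $\mathbb{E}_f$ denotes the expectation with respect to the distribution of the data $(y_k)$ when the unknown function is $f$. For $g\in L^2[-1,1]$, $\|g\|=\left(\int_{-1}^1g^2(x)\,dx\right)^{1/2}$.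 The floor function is $\lfloor x\rfloor=\max\{n\in\mathbb{Z}: n\le x\}$.
   Formalization: The supremum is over f in W^r_2 with sum k^{2r}|θ_k|^2 ≤ L (over all of W^r_2 it is infinite); α is restricted to 0 < α < 1/log(1+√2) (above this the variance diverges); r > 0; and C may depend on r, α and L but not on f or ε. *)

theory Defs
  imports "HOL-Probability.Probability" "HOL-Computational_Algebra.Polynomial"
begin

abbreviation I11 :: "real measure" where
  "I11 \<equiv> lebesgue_on {-1..1}"

(* Functions stand for their classes modulo equality a.e. on [-1,1]; everything
   below depends on f only through its values almost everywhere on [-1,1]. *)
definition L2 :: "(real \<Rightarrow> real) set" where
  "L2 = {f. f \<in> borel_measurable I11 \<and> integrable I11 (\<lambda>x. (f x)\<^sup>2)}"

definition L2norm :: "(real \<Rightarrow> real) \<Rightarrow> real" where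
  "L2norm g = sqrt (\<integral>x. (g x)\<^sup>2 \<partial>I11)"

(* Rodrigues' formula, with the factor sqrt ((2k+1)/2) that makes the L2 norm 1. *)
definition legendre :: "nat \<Rightarrow> real poly" where
  "legendre k = smult (sqrt ((2 * real k + 1) / 2) / (2 ^ k * fact k))
                  ((pderiv ^^ k) ([:-1, 0, 1:] ^ k))"

definition legendre_coeff :: "(real \<Rightarrow> real) \<Rightarrow> nat \<Rightarrow> real" where
  "legendre_coeff f k = (\<integral>x. f x * poly (legendre k) x \<partial>I11)"

definition sobolev :: "real \<Rightarrow> (real \<Rightarrow> real) set" where
  "sobolev r = {f \<in> L2. summable (\<lambda>k. real k powr (2 * r) * \<bar>legendre_coeff f k\<bar>\<^sup>2)}"

(* The space sobolev r is closed under scaling, so for every estimator that is a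
   polynomial of bounded degree the supremum of the risk over the whole space is infinite.
   Uniform risk bounds are therefore stated over the Sobolev classes of finite radius,
   whose union is sobolev r. *)
definition sobolev_class :: "real \<Rightarrow> real \<Rightarrow> (real \<Rightarrow> real) set" where
  "sobolev_class r L =
     {f \<in> sobolev r. (\<Sum>k. real k powr (2 * r) * \<bar>legendre_coeff f k\<bar>\<^sup>2) \<le> L}"

definition moment :: "(real \<Rightarrow> real) \<Rightarrow> nat \<Rightarrow> real" where
  "moment f k = (\<integral>x. x ^ k * f x \<partial>I11)"

definition iid_std_normal :: "'w measure \<Rightarrow> (nat \<Rightarrow> 'w \<Rightarrow> real) \<Rightarrow> bool" where
  "iid_std_normal M \<xi> \<longleftrightarrow>
     prob_space M \<and> prob_space.indep_vars M (\<lambda>_. borel) \<xi> UNIV \<and>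
     (\<forall>k. distributed M lborel (\<xi> k) std_normal_density)"

definition noisy_moment ::
    "(real \<Rightarrow> real) \<Rightarrow> real \<Rightarrow> (nat \<Rightarrow> 'w \<Rightarrow> real) \<Rightarrow> 'w \<Rightarrow> nat \<Rightarrow> real" where
  "noisy_moment f \<epsilon> \<xi> \<omega> k = moment f k + \<epsilon> * \<xi> k \<omega>"

definition legendre_estimator :: "nat \<Rightarrow> (nat \<Rightarrow> real) \<Rightarrow> real \<Rightarrow> real" where
  "legendre_estimator N y x =
     (\<Sum>k\<le>N. \<Sum>j\<le>k. coeff (legendre k) j * y j * poly (legendre k) x)"

(* Valued in ennreal, so that neither the expectation nor a supremum of risks
   can take an arbitrary default value. *)
definition risk ::
    "'w measure \<Rightarrow> (nat \<Rightarrow> 'w \<Rightarrow> real) \<Rightarrow> real \<Rightarrow> nat \<Rightarrow> (real \<Rightarrow> real) \<Rightarrow> ennreal" where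
  "risk M \<xi> \<epsilon> N f =
     (\<integral>\<^sup>+\<omega>. ennreal ((L2norm (\<lambda>x. legendre_estimator N (noisy_moment f \<epsilon> \<xi> \<omega>) x - f x))\<^sup>2) \<partial>M)"

(* The variance of the estimator is eps^2 times the sum of all squared coefficients of the
   normalized Legendre polynomials up to degree N, which grows like (1 + sqrt 2)^(2N) / sqrt N.
   It tends to 0 along this cutoff when alpha * ln (1 + sqrt 2) < 1 and diverges when
   alpha * ln (1 + sqrt 2) > 1. *)
definition cutoff :: "real \<Rightarrow> real \<Rightarrow> nat" where
  "cutoff \<alpha> \<epsilon> = nat \<lfloor>\<alpha> * ln (1 / \<epsilon>)\<rfloor>"

end

theory Submission
  imports Defs
begin

text \<open>
  Write \<theta>_k for the Legendre coefficients of f and T for the logarithm of 1 / \<epsilon>.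
  Since \<theta>_k is the combination of the moments of f with the coefficients of P_k as weights,
  the estimator is the partial sum of the Legendre series of f in which each \<theta>_k is
  perturbed by \<epsilon> times a combination of the noise variables.  Orthonormality turns the
  squared error into a squared bias plus a stochastic term, without any cross term
  (\<open>L2norm_estimator_error_square\<close>).

  The bias is the energy of f that its Legendre coefficients up to N miss.  Polynomials are
  dense in \<open>L2\<close>, so this energy is the sum of \<theta>_k^2 over k > N, and the Sobolev
  weights bound it by L (N + 1)^(-2r) (\<open>legendre_tail_le\<close>).  For N = \<open>cutoff \<alpha> \<epsilon>\<close> we
  have N + 1 > \<alpha> T, which gives the rate T^(-2r).

  The stochastic term costs \<epsilon>^2 times, up to polynomial factors, the sum of the squared
  coefficients of P_0, ..., P_N.  The whole proof rests on the sharp exponential size of these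
  coefficients: the absolute coefficients of P_k sum to at most (1 + sqrt 2)^k up to a
  factor of order sqrt k (\<open>sum_abs_coeff_legendre_le\<close>).  As \<epsilon>^2 = exp (-2T), the stochastic
  term is at most a cubic polynomial in T times exp (-2T (1 - \<alpha> ln (1 + sqrt 2))), and the
  assumption on \<alpha> says exactly that this decays exponentially in T
  (\<open>variance_le_powr\<close>).  It is therefore dominated by the bound on the bias.

  The constant is uniform over all \<epsilon> in (0,1), including \<epsilon> near 1, where N = 0: there
  T^(-2r) is large, and the mean of f, the one coefficient that the Sobolev weights do not
  control, is estimated rather than left in the bias.
\<close>

section \<open>Size of the Legendre coefficients\<close>

text \<open>
  If the coefficients of one polynomial bound those of another in absolute value, the same holds
  for all their powers.  This replaces the signs in Rodrigues' formula by plus signs.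
\<close>
lemma abs_coeff_power_le_majorant:
  fixes p q :: "real poly"
  assumes "\<And>m. \<bar>coeff p m\<bar> \<le> coeff q m"
  shows "\<bar>coeff (p ^ k) m\<bar> \<le> coeff (q ^ k) m"
proof (induction k arbitrary: m)
  case 0
  show ?case by (simp add: coeff_1)
next
  case (Suc k)
  have "\<bar>coeff (p ^ Suc k) m\<bar> \<le> (\<Sum>i\<le>m. \<bar>coeff p i * coeff (p ^ k) (m - i)\<bar>)"
    by (simp add: coeff_mult)
  also have "\<dots> \<le> (\<Sum>i\<le>m. coeff q i * coeff (q ^ k) (m - i))"
    using assms Suc.IH by (intro sum_mono) (simp add: abs_mult mult_mono' )
  finally show ?case by (simp add: coeff_mult)
qed

lemma binomial_times_power_le:
  fixes t :: real
  assumes "t \<ge> 0"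
  shows "real (m choose k) * t ^ k \<le> (1 + t) ^ m"
proof (cases "k \<le> m")
  case True
  have "real (m choose k) * t ^ k \<le> (\<Sum>i\<le>m. real (m choose i) * t ^ i)"
    using True assms by (intro member_le_sum) auto
  also have "\<dots> = (1 + t) ^ m"
    using binomial_ring[of t 1 m] by (simp add: add.commute)
  finally show ?thesis .
next
  case False
  then show ?thesis using assms by (simp add: binomial_eq_0)
qed

lemma coeff_higher_pderiv_binomial:
  fixes p :: "real poly"
  shows "coeff ((pderiv ^^ k) p) j = fact k * real ((j + k) choose k) * coeff p (j + k)"
proof -
  have "real ((j + k) choose k) = pochhammer (real (Suc j)) k / fact k"
    by (simp add: binomial_gbinomial gbinomial_pochhammer' add.commute)
  then show ?thesis by (simp add: coeff_higher_pderiv)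
qed

text \<open>
  By Rodrigues' formula and the majorant above, the absolute coefficients of P_k sum, up to the
  normalization, to at most 2^(-k) / k! times the k-th derivative of (x^2 + 1)^k at x = 1, that
  is, to 2^(-k) times the coefficient of t^k in ((1 + t)^2 + 1)^k.  All coefficients being
  nonnegative, that coefficient is at most ((1 + t)^2 + 1)^k / t^k = (2 / t + 2 + t)^k for every
  t > 0.  The minimum, at t = sqrt 2, is (2 + 2 sqrt 2)^k.
\<close>
lemma sum_abs_coeff_legendre_le:
  "(\<Sum>j\<le>k. \<bar>coeff (legendre k) j\<bar>) \<le> sqrt ((2 * real k + 1) / 2) * (1 + sqrt 2) ^ k"
proof -
  define q :: "real poly" where "q = [:1, 0, 1:] ^ k"
  define c where "c = sqrt ((2 * real k + 1) / 2)"
  have c0: "c \<ge> 0" by (simp add: c_def)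
  have maj: "\<bar>coeff ([:-1, 0, 1:] ^ k :: real poly) m\<bar> \<le> coeff q m" for m
    unfolding q_def
    by (rule abs_coeff_power_le_majorant) (auto simp: coeff_pCons split: nat.split)
  have q0: "coeff q m \<ge> 0" for m
    using maj[of m] by linarith
  have degq: "degree q \<le> 2 * k"
    unfolding q_def using degree_power_le[of "[:1, 0, 1:] :: real poly" k] by simp
  have abs_coeff: "\<bar>coeff (legendre k) j\<bar> \<le> c / 2 ^ k * (real ((j + k) choose k) * coeff q (j + k))" for j
  proof -
    have "\<bar>coeff (legendre k) j\<bar>
        = c / 2 ^ k * (real ((j + k) choose k) * \<bar>coeff ([:-1, 0, 1:] ^ k :: real poly) (j + k)\<bar>)"
      using c0 by (simp add: legendre_def coeff_higher_pderiv_binomial abs_mult c_def)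
    also have "\<dots> \<le> c / 2 ^ k * (real ((j + k) choose k) * coeff q (j + k))"
      using c0 by (intro mult_left_mono maj) auto
    finally show ?thesis .
  qed
  (* The point t = sqrt 2 minimizes 2 / t + 2 + t. *)
  have "sqrt 2 ^ k * (\<Sum>j\<le>k. real ((j + k) choose k) * coeff q (j + k))
      = (\<Sum>j\<le>k. (real ((j + k) choose k) * sqrt 2 ^ k) * coeff q (j + k))"
    by (simp add: sum_distrib_left mult_ac)
  also have "\<dots> \<le> (\<Sum>j\<le>k. coeff q (j + k) * (1 + sqrt 2) ^ (j + k))"
  proof (intro sum_mono)
    fix j
    show "(real ((j + k) choose k) * sqrt 2 ^ k) * coeff q (j + k)
        \<le> coeff q (j + k) * (1 + sqrt 2) ^ (j + k)"
      using mult_right_mono[OF binomial_times_power_le[of "sqrt 2" "j + k" k] q0[of "j + k"]]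
      by (simp add: mult.commute)
  qed
  also have "\<dots> = (\<Sum>m\<in>{k..2 * k}. coeff q m * (1 + sqrt 2) ^ m)"
    by (rule sum.reindex_bij_witness[of _ "\<lambda>m. m - k" "\<lambda>j. j + k"]) auto
  also have "\<dots> \<le> (\<Sum>m\<le>2 * k. coeff q m * (1 + sqrt 2) ^ m)"
    using q0 by (intro sum_mono2) auto
  also have "\<dots> = poly q (1 + sqrt 2)"
    unfolding poly_altdef using degq
    by (intro sum.mono_neutral_right) (auto simp: coeff_eq_0)
  also have "\<dots> = (4 + 2 * sqrt 2) ^ k"
    by (simp add: q_def algebra_simps)
  also have "\<dots> = sqrt 2 ^ k * (2 ^ k * (1 + sqrt 2) ^ k)"
    by (simp add: power_mult_distrib[symmetric] algebra_simps)
  finally have "(\<Sum>j\<le>k. real ((j + k) choose k) * coeff q (j + k)) \<le> 2 ^ k * (1 + sqrt 2) ^ k"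
    by simp
  then have "c / 2 ^ k * (\<Sum>j\<le>k. real ((j + k) choose k) * coeff q (j + k))
      \<le> c / 2 ^ k * (2 ^ k * (1 + sqrt 2) ^ k)"
    using c0 by (intro mult_left_mono) auto
  moreover have "(\<Sum>j\<le>k. \<bar>coeff (legendre k) j\<bar>)
      \<le> c / 2 ^ k * (\<Sum>j\<le>k. real ((j + k) choose k) * coeff q (j + k))"
    unfolding sum_distrib_left by (intro sum_mono abs_coeff)
  ultimately show ?thesis by (simp add: c_def)
qed

lemma sum_coeff_legendre_sq_le:
  "(\<Sum>j\<le>k. (coeff (legendre k) j)\<^sup>2) \<le> real (k + 1) * (1 + sqrt 2) ^ (2 * k)"
proof -
  have "(\<Sum>j\<le>k. (coeff (legendre k) j)\<^sup>2) \<le> (\<Sum>j\<le>k. \<bar>coeff (legendre k) j\<bar>)\<^sup>2"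
  proof -
    have "(\<Sum>j\<le>k. (coeff (legendre k) j)\<^sup>2) = (L2_set (coeff (legendre k)) {..k})\<^sup>2"
      by (simp add: L2_set_def sum_nonneg)
    also have "\<dots> \<le> (\<Sum>j\<le>k. \<bar>coeff (legendre k) j\<bar>)\<^sup>2"
      by (intro power_mono L2_set_le_sum_abs L2_set_nonneg)
    finally show ?thesis .
  qed
  also have "\<dots> \<le> (sqrt ((2 * real k + 1) / 2) * (1 + sqrt 2) ^ k)\<^sup>2"
    by (intro power_mono sum_abs_coeff_legendre_le sum_nonneg) auto
  also have "\<dots> = (2 * real k + 1) / 2 * (1 + sqrt 2) ^ (2 * k)"
    by (simp add: power_mult_distrib power_mult[symmetric] mult.commute)
  also have "\<dots> \<le> real (k + 1) * (1 + sqrt 2) ^ (2 * k)"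
    by (intro mult_right_mono) auto
  finally show ?thesis .
qed

section \<open>Orthonormality\<close>

lemma integrable_poly: "integrable I11 (\<lambda>x. poly p x)"
  by (intro continuous_imp_integrable_real continuous_intros)

lemma integral_pderiv: "(\<integral>x. poly (pderiv p) x \<partial>I11) = poly p 1 - poly p (-1)"
proof -
  have "((\<lambda>x. poly (pderiv p) x) has_integral (poly p 1 - poly p (-1))) {-1..1}"
    by (rule fundamental_theorem_of_calculus)
       (auto simp: has_real_derivative_iff_has_vector_derivative[symmetric]
             intro: has_field_derivative_at_within poly_DERIV)
  then show ?thesis
    by (simp add: lebesgue_integral_eq_integral integrable_poly integral_unique)
qed

lemma integral_mult_pderiv:
  assumes "poly u 1 = 0" "poly u (-1) = 0"
  shows "(\<integral>x. poly (q * pderiv u) x \<partial>I11) = - (\<integral>x. poly (pderiv q * u) x \<partial>I11)"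
proof -
  have "(\<integral>x. poly (q * pderiv u) x + poly (pderiv q * u) x \<partial>I11)
      = (\<integral>x. poly (pderiv (q * u)) x \<partial>I11)"
    by (intro Bochner_Integration.integral_cong) (auto simp: pderiv_mult)
  also have "\<dots> = 0" using assms by (simp add: integral_pderiv)
  finally have "(\<integral>x. poly (q * pderiv u) x \<partial>I11) + (\<integral>x. poly (pderiv q * u) x \<partial>I11) = 0"
    by (simp only: Bochner_Integration.integral_add[OF integrable_poly integrable_poly])
  then show ?thesis by (simp del: poly_mult)
qed

lemma integral_mult_higher_pderiv:
  assumes "\<And>i. i < k \<Longrightarrow> poly ((pderiv ^^ i) u) 1 = 0 \<and> poly ((pderiv ^^ i) u) (-1) = 0"
  shows "(\<integral>x. poly (q * (pderiv ^^ k) u) x \<partial>I11) = (-1) ^ k * (\<integral>x. poly ((pderiv ^^ k) q * u) x \<partial>I11)"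
  using assms
proof (induction k arbitrary: q)
  case (Suc k)
  have "(\<integral>x. poly (q * (pderiv ^^ Suc k) u) x \<partial>I11)
      = - (\<integral>x. poly (pderiv q * (pderiv ^^ k) u) x \<partial>I11)"
    using integral_mult_pderiv[of "(pderiv ^^ k) u" q] Suc.prems[of k] by simp
  also have "\<dots> = - ((-1) ^ k * (\<integral>x. poly ((pderiv ^^ k) (pderiv q) * u) x \<partial>I11))"
    using Suc.IH[of "pderiv q"] Suc.prems by simp
  finally show ?case by (simp add: funpow_swap1 del: poly_mult)
qed simp

text \<open>
  Each derivative lowers the multiplicity of a zero by at most one; this makes all boundary terms
  vanish when Rodrigues' formula is integrated by parts.
\<close>
lemma power_dvd_pderiv:
  fixes p v :: "real poly"
  assumes "p ^ Suc m dvd v"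
  shows "p ^ m dvd pderiv v"
proof -
  from assms obtain w where v: "v = p ^ Suc m * w" by (elim dvdE)
  show ?thesis
    unfolding v pderiv_mult pderiv_power_Suc
    by (intro dvd_add dvd_mult dvd_mult2 dvd_smult) auto
qed

lemma poly_higher_pderiv_power_eq_0:
  fixes p :: "real poly"
  assumes "poly p c = 0" "i < k"
  shows "poly ((pderiv ^^ i) (p ^ k)) c = 0"
proof -
  have "i \<le> k \<Longrightarrow> p ^ (k - i) dvd (pderiv ^^ i) (p ^ k)" for i
  proof (induction i)
    case (Suc i)
    then have "p ^ Suc (k - Suc i) dvd (pderiv ^^ i) (p ^ k)"
      by (simp add: Suc_diff_Suc del: power_Suc)
    then show ?case by (simp add: power_dvd_pderiv)
  qed simp
  from this[of i] assms(2) obtain w where w: "(pderiv ^^ i) (p ^ k) = p ^ (k - i) * w"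
    by (auto elim: dvdE)
  show ?thesis using assms by (simp add: w)
qed

lemma degree_rodrigues: "degree ([:-1, 0, 1:] ^ k :: real poly) = 2 * k"
  by (simp add: degree_power_eq)

lemma coeff_rodrigues_top: "coeff ([:-1, 0, 1:] ^ k :: real poly) (2 * k) = 1"
  using lead_coeff_power[of "[:-1, 0, 1:] :: real poly" k] by (simp add: degree_rodrigues)

lemma integral_mult_rodrigues:
  "(\<integral>x. poly (q * (pderiv ^^ k) ([:-1, 0, 1:] ^ k)) x \<partial>I11)
     = (-1) ^ k * (\<integral>x. poly ((pderiv ^^ k) q * [:-1, 0, 1:] ^ k) x \<partial>I11)"
  by (rule integral_mult_higher_pderiv) (auto intro!: poly_higher_pderiv_power_eq_0)

lemma integral_mult_legendre_eq_0:
  assumes "degree q < k"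
  shows "(\<integral>x. poly q x * poly (legendre k) x \<partial>I11) = 0"
proof -
  have "(pderiv ^^ k) q = 0"
    using assms by (intro poly_eqI) (simp add: coeff_higher_pderiv coeff_eq_0)
  then have "(\<integral>x. poly (q * (pderiv ^^ k) ([:-1, 0, 1:] ^ k)) x \<partial>I11) = 0"
    unfolding integral_mult_rodrigues by (simp add: poly_0[abs_def])
  moreover have "(\<lambda>x. poly q x * poly (legendre k) x)
      = (\<lambda>x. sqrt ((2 * real k + 1) / 2) / (2 ^ k * fact k)
              * poly (q * (pderiv ^^ k) ([:-1, 0, 1:] ^ k)) x)"
    by (simp only: legendre_def poly_smult poly_mult mult_ac)
  ultimately show ?thesis
    by (simp only: integral_mult_right_zero mult_zero_right)
qed

lemma coeff_legendre_top: "coeff (legendre k) k \<noteq> 0"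
proof -
  have "coeff (legendre k) k
      = sqrt ((2 * real k + 1) / 2) / 2 ^ k * real ((k + k) choose k) * coeff ([:-1, 0, 1:] ^ k :: real poly) (2 * k)"
    by (simp add: legendre_def coeff_higher_pderiv_binomial flip: mult_2)
  also have "\<dots> \<noteq> 0"
    unfolding coeff_rodrigues_top by (simp add: binomial_eq_0_iff)
  finally show ?thesis .
qed

lemma degree_legendre: "degree (legendre k) = k"
proof (rule antisym)
  show "degree (legendre k) \<le> k"
    by (intro degree_le) (auto simp: legendre_def coeff_higher_pderiv coeff_eq_0 degree_rodrigues)
  show "k \<le> degree (legendre k)"
    by (rule le_degree[OF coeff_legendre_top])
qed

text \<open>
  The derivative of x (1 - x^2)^(k+1) integrates to 0, and rewriting x^2 as 1 - (1 - x^2) in it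
  yields a two-term recurrence for these Wallis integrals.
\<close>
lemma integral_one_minus_square_power:
  "(\<integral>x. (1 - x\<^sup>2) ^ k \<partial>I11) = 2 ^ (2 * k + 1) * (fact k)\<^sup>2 / fact (2 * k + 1)"
proof (induction k)
  case 0
  show ?case using integral_pderiv[of "[:0, 1:]"] by (simp add: pderiv_pCons)
next
  case (Suc k)
  let ?q = "[:1, 0, -1:] :: real poly"
  have int: "integrable I11 (\<lambda>x. (1 - x\<^sup>2) ^ n)" for n :: nat
    by (intro continuous_imp_integrable_real continuous_intros)
  have eq: "poly (pderiv ([:0, 1:] * ?q ^ Suc k)) x
      = (2 * real k + 3) * (1 - x\<^sup>2) ^ Suc k - 2 * (real k + 1) * (1 - x\<^sup>2) ^ k" for x
    unfolding pderiv_mult pderiv_power_Suc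
    by (simp add: pderiv_pCons) (simp add: algebra_simps power2_eq_square)
  have "0 = (\<integral>x. poly (pderiv ([:0, 1:] * ?q ^ Suc k)) x \<partial>I11)"
    by (simp add: integral_pderiv)
  also have "\<dots> = (2 * real k + 3) * (\<integral>x. (1 - x\<^sup>2) ^ Suc k \<partial>I11)
                 - 2 * (real k + 1) * (\<integral>x. (1 - x\<^sup>2) ^ k \<partial>I11)"
    unfolding eq by (subst Bochner_Integration.integral_diff) (auto intro: int simp del: power_Suc)
  finally have "(\<integral>x. (1 - x\<^sup>2) ^ Suc k \<partial>I11)
      = 2 * (real k + 1) / (2 * real k + 3) * (\<integral>x. (1 - x\<^sup>2) ^ k \<partial>I11)"
    by (simp add: field_simps del: power_Suc)
  also have "\<dots> = 2 ^ (2 * Suc k + 1) * (fact (Suc k))\<^sup>2 / fact (2 * Suc k + 1)"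
    unfolding Suc.IH by (simp add: divide_simps) (simp add: algebra_simps power2_eq_square)
  finally show ?case .
qed

text \<open>
  Moving all k derivatives to one side leaves the 2k-th derivative of (x^2 - 1)^k, which is the
  constant (2k)!, and a Wallis integral.
\<close>
lemma integral_legendre_square: "(\<integral>x. (poly (legendre k) x)\<^sup>2 \<partial>I11) = 1"
proof -
  define u :: "real poly" where "u = [:-1, 0, 1:] ^ k"
  define c where "c = sqrt ((2 * real k + 1) / 2) / (2 ^ k * fact k)"
  have D: "(pderiv ^^ k) ((pderiv ^^ k) u) = [:fact (2 * k):]"
  proof (intro poly_eqI)
    fix n
    have "coeff ((pderiv ^^ k) ((pderiv ^^ k) u)) n = coeff ((pderiv ^^ (2 * k)) u) n"
      by (simp add: funpow_add mult_2)
    also have "\<dots> = pochhammer (real (Suc n)) (2 * k) * coeff u (n + 2 * k)"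
      by (rule coeff_higher_pderiv)
    also have "\<dots> = coeff [:fact (2 * k):] n"
      by (cases n) (simp_all add: u_def coeff_rodrigues_top pochhammer_fact coeff_eq_0 degree_rodrigues)
    finally show "coeff ((pderiv ^^ k) ((pderiv ^^ k) u)) n = coeff [:fact (2 * k):] n" .
  qed
  have "legendre k = smult c ((pderiv ^^ k) u)"
    by (simp only: legendre_def u_def c_def)
  then have "(\<integral>x. (poly (legendre k) x)\<^sup>2 \<partial>I11)
      = (\<integral>x. c\<^sup>2 * poly ((pderiv ^^ k) u * (pderiv ^^ k) u) x \<partial>I11)"
    by (simp only: poly_smult poly_mult power2_eq_square mult_ac)
  also have "\<dots> = c\<^sup>2 * (\<integral>x. poly ((pderiv ^^ k) u * (pderiv ^^ k) u) x \<partial>I11)"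
    by simp
  also have "(\<integral>x. poly ((pderiv ^^ k) u * (pderiv ^^ k) u) x \<partial>I11)
      = (-1) ^ k * (\<integral>x. fact (2 * k) * poly u x \<partial>I11)"
    unfolding u_def integral_mult_rodrigues by (simp add: D[unfolded u_def] poly_smult[abs_def])
  also have "\<dots> = fact (2 * k) * (\<integral>x. (-1) ^ k * poly u x \<partial>I11)"
    by simp
  also have "(\<lambda>x. (-1) ^ k * poly u x) = (\<lambda>x. (1 - x\<^sup>2) ^ k)"
    by (simp add: u_def power_mult_distrib[symmetric] power2_eq_square)
  also have "c\<^sup>2 * (fact (2 * k) * (\<integral>x. (1 - x\<^sup>2) ^ k \<partial>I11)) = 1"
  proof -
    have c2: "c\<^sup>2 = (2 * real k + 1) / 2 / (2 ^ (2 * k) * (fact k)\<^sup>2)"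
      by (simp add: c_def power_divide power_mult_distrib mult.commute flip: power_mult)
    have f: "fact (2 * k + 1) = (2 * real k + 1) * fact (2 * k)"
      by simp
    show ?thesis
      unfolding integral_one_minus_square_power c2 f by (simp add: divide_simps)
  qed
  finally show ?thesis .
qed

lemma legendre_orthonormal:
  "(\<integral>x. poly (legendre i) x * poly (legendre k) x \<partial>I11) = (if i = k then 1 else 0)"
proof (cases i k rule: linorder_cases)
  case less
  then show ?thesis by (simp add: integral_mult_legendre_eq_0 degree_legendre)
next
  case equal
  then show ?thesis using integral_legendre_square[of k] by (simp add: power2_eq_square)
next
  case greater
  then show ?thesis
    using integral_mult_legendre_eq_0[of "legendre k" i] by (simp add: degree_legendre mult.commute)
qed

lemma poly_eq_sum_legendre:
  assumes "degree p \<le> n"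
  shows "\<exists>a. p = (\<Sum>k\<le>n. smult (a k) (legendre k))"
  using assms
proof (induction n arbitrary: p)
  case 0
  define a where "a = coeff p 0 / coeff (legendre 0) 0"
  have "p = smult a (legendre 0)"
  proof (intro poly_eqI)
    fix n show "coeff p n = coeff (smult a (legendre 0)) n"
      using 0 coeff_legendre_top[of 0]
      by (cases n) (simp_all add: a_def coeff_eq_0 degree_legendre)
  qed
  then show ?case by (intro exI[of _ "\<lambda>_. a"]) simp
next
  case (Suc n)
  define b where "b = coeff p (Suc n) / coeff (legendre (Suc n)) (Suc n)"
  have "degree (p - smult b (legendre (Suc n))) \<le> n"
  proof (intro degree_le allI impI)
    fix i assume "n < i"
    then consider "i = Suc n" | "Suc n < i" by linarith
    then show "coeff (p - smult b (legendre (Suc n))) i = 0"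
      using Suc.prems coeff_legendre_top[of "Suc n"]
      by cases (simp_all add: b_def coeff_eq_0 degree_legendre)
  qed
  from Suc.IH[OF this] obtain a
    where a: "p - smult b (legendre (Suc n)) = (\<Sum>k\<le>n. smult (a k) (legendre k))" by blast
  have "(\<Sum>k\<le>Suc n. smult ((a(Suc n := b)) k) (legendre k))
      = (\<Sum>k\<le>n. smult (a k) (legendre k)) + smult b (legendre (Suc n))"
    by simp
  then have "p = (\<Sum>k\<le>Suc n. smult ((a(Suc n := b)) k) (legendre k))"
    using a by (metis diff_add_cancel)
  then show ?case by blast
qed

section \<open>Expansions of square integrable functions\<close>

lemma borel_measurable_poly_I11: "(\<lambda>x. poly p x) \<in> borel_measurable I11"
  using integrable_poly by (rule borel_measurable_integrable)

lemma poly_in_L2: "(\<lambda>x. poly p x) \<in> L2"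
  using integrable_poly[of "p * p"]
  by (simp add: L2_def borel_measurable_poly_I11 power2_eq_square)

lemma integrable_mult_L2:
  assumes "f \<in> L2" "g \<in> L2"
  shows "integrable I11 (\<lambda>x. f x * g x)"
proof (rule Bochner_Integration.integrable_bound)
  show "integrable I11 (\<lambda>x. (f x)\<^sup>2 + (g x)\<^sup>2)"
    using assms by (simp add: L2_def)
  show "(\<lambda>x. f x * g x) \<in> borel_measurable I11"
    using assms by (intro borel_measurable_times) (auto simp: L2_def)
  have le: "\<bar>a * b\<bar> \<le> \<bar>a\<^sup>2 + b\<^sup>2\<bar>" for a b :: real
  proof -
    have "2 * \<bar>a * b\<bar> \<le> a\<^sup>2 + b\<^sup>2"
      using sum_squares_bound[of "\<bar>a\<bar>" "\<bar>b\<bar>"] by (simp add: abs_mult)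
    then show ?thesis by linarith
  qed
  show "AE x in I11. norm (f x * g x) \<le> norm ((f x)\<^sup>2 + (g x)\<^sup>2)"
    unfolding real_norm_def by (intro AE_I2 le)
qed

lemma diff_in_L2:
  assumes "f \<in> L2" "g \<in> L2"
  shows "(\<lambda>x. f x - g x) \<in> L2"
proof -
  have "integrable I11 (\<lambda>x. (f x)\<^sup>2 + (g x)\<^sup>2 - 2 * (f x * g x))"
    using assms
    by (intro Bochner_Integration.integrable_add Bochner_Integration.integrable_diff
        integrable_mult_right integrable_mult_L2) (auto simp: L2_def)
  moreover have "(\<lambda>x. f x - g x) \<in> borel_measurable I11"
    using assms by (intro borel_measurable_diff) (auto simp: L2_def)
  ultimately show ?thesis
    by (simp add: L2_def power2_diff mult.assoc)
qed

lemma legendre_coeff_eq_sum_moments: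
  assumes "f \<in> L2"
  shows "legendre_coeff f k = (\<Sum>j\<le>k. coeff (legendre k) j * moment f j)"
proof -
  have int: "integrable I11 (\<lambda>x. x ^ j * f x)" for j
    using integrable_mult_L2[OF poly_in_L2[of "monom 1 j"] assms] by (simp add: poly_monom)
  have "legendre_coeff f k = (\<integral>x. (\<Sum>j\<le>k. coeff (legendre k) j * (x ^ j * f x)) \<partial>I11)"
    unfolding legendre_coeff_def
    by (intro Bochner_Integration.integral_cong)
       (auto simp: poly_altdef degree_legendre sum_distrib_left mult_ac)
  also have "\<dots> = (\<Sum>j\<le>k. \<integral>x. coeff (legendre k) j * (x ^ j * f x) \<partial>I11)"
    by (intro Bochner_Integration.integral_sum integrable_mult_right int)
  finally show ?thesis by (simp add: moment_def)
qed

text \<open>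
  The Pythagorean identity in coordinates.  With the perturbed coefficients in the role of a it
  splits the error of the estimator into bias and noise; with the expansion of an arbitrary
  polynomial it says that the Legendre partial sum is the best approximation.
\<close>
lemma integral_legendre_sum_diff_square:
  assumes "f \<in> L2"
  shows "(\<integral>x. ((\<Sum>k\<le>n. a k * poly (legendre k) x) - f x)\<^sup>2 \<partial>I11)
           = (\<integral>x. (f x)\<^sup>2 \<partial>I11) - (\<Sum>k\<le>n. (legendre_coeff f k)\<^sup>2)
             + (\<Sum>k\<le>n. (a k - legendre_coeff f k)\<^sup>2)"
proof -
  define P where "P k = (\<lambda>x. poly (legendre k) x)" for k
  have fP: "integrable I11 (\<lambda>x. f x * P k x)" for k
    unfolding P_def by (intro integrable_mult_L2 assms poly_in_L2)
  have PP: "integrable I11 (\<lambda>x. P i x * P k x)" for i k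
    unfolding P_def by (intro integrable_mult_L2 poly_in_L2)
  have ff: "integrable I11 (\<lambda>x. (f x)\<^sup>2)"
    using assms by (simp add: L2_def)
  have "(\<integral>x. ((\<Sum>k\<le>n. a k * P k x) - f x)\<^sup>2 \<partial>I11)
      = (\<integral>x. (f x)\<^sup>2 - (\<Sum>k\<le>n. 2 * a k * (f x * P k x))
              + (\<Sum>i\<le>n. \<Sum>k\<le>n. a i * a k * (P i x * P k x)) \<partial>I11)"
  proof (intro Bochner_Integration.integral_cong refl)
    fix x
    define S where "S = (\<Sum>k\<le>n. a k * P k x)"
    have "(\<Sum>k\<le>n. 2 * a k * (f x * P k x)) = 2 * f x * S"
      unfolding S_def sum_distrib_left by (intro sum.cong) auto
    moreover have "(\<Sum>i\<le>n. \<Sum>k\<le>n. a i * a k * (P i x * P k x)) = S * S"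
      unfolding S_def sum_product by (intro sum.cong) auto
    ultimately show "((\<Sum>k\<le>n. a k * P k x) - f x)\<^sup>2 = (f x)\<^sup>2 - (\<Sum>k\<le>n. 2 * a k * (f x * P k x))
              + (\<Sum>i\<le>n. \<Sum>k\<le>n. a i * a k * (P i x * P k x))"
      unfolding S_def[symmetric] by (simp add: power2_eq_square algebra_simps)
  qed
  also have "\<dots> = (\<integral>x. (f x)\<^sup>2 \<partial>I11) - (\<Sum>k\<le>n. 2 * a k * (\<integral>x. f x * P k x \<partial>I11))
              + (\<Sum>i\<le>n. \<Sum>k\<le>n. a i * a k * (\<integral>x. P i x * P k x \<partial>I11))"
  proof -
    have cross: "integrable I11 (\<lambda>x. 2 * a k * (f x * P k x))" for k
      by (intro integrable_mult_right fP)
    have gram: "integrable I11 (\<lambda>x. a i * a k * (P i x * P k x))" for i k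
      by (intro integrable_mult_right PP)
    have gram_sum: "integrable I11 (\<lambda>x. \<Sum>k\<le>n. a i * a k * (P i x * P k x))" for i
      by (intro Bochner_Integration.integrable_sum gram)
    have cross_sum: "integrable I11 (\<lambda>x. \<Sum>k\<le>n. 2 * a k * (f x * P k x))"
      by (intro Bochner_Integration.integrable_sum cross)
    show ?thesis
      by (simp only: Bochner_Integration.integral_add[OF Bochner_Integration.integrable_diff[OF ff cross_sum]
            Bochner_Integration.integrable_sum[OF gram_sum]]
          Bochner_Integration.integral_diff[OF ff cross_sum]
          Bochner_Integration.integral_sum[OF cross] Bochner_Integration.integral_sum[OF gram_sum]
          Bochner_Integration.integral_sum[OF gram] integral_mult_right_zero)
  qed
  also have "(\<Sum>i\<le>n. \<Sum>k\<le>n. a i * a k * (\<integral>x. P i x * P k x \<partial>I11)) = (\<Sum>k\<le>n. (a k)\<^sup>2)"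
  proof (intro sum.cong refl)
    fix i assume "i \<in> {..n}"
    have "(\<Sum>k\<le>n. a i * a k * (\<integral>x. P i x * P k x \<partial>I11)) = (\<Sum>k\<le>n. if i = k then a i * a k else 0)"
      by (intro sum.cong) (auto simp: P_def legendre_orthonormal)
    also have "\<dots> = (a i)\<^sup>2"
      using \<open>i \<in> {..n}\<close> by (simp add: power2_eq_square)
    finally show "(\<Sum>k\<le>n. a i * a k * (\<integral>x. P i x * P k x \<partial>I11)) = (a i)\<^sup>2" .
  qed
  also have "(\<Sum>k\<le>n. 2 * a k * (\<integral>x. f x * P k x \<partial>I11)) = (\<Sum>k\<le>n. 2 * a k * legendre_coeff f k)"
    by (simp add: legendre_coeff_def P_def)
  finally show ?thesis
    unfolding P_def by (simp add: power2_diff sum.distrib sum_subtractf sum_distrib_left mult_ac)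
qed

section \<open>Density of the polynomials\<close>

lemma integral_diff_square_triangle:
  assumes "f \<in> L2" "g \<in> L2" "h \<in> L2"
  shows "(\<integral>x. (f x - h x)\<^sup>2 \<partial>I11)
           \<le> 2 * (\<integral>x. (f x - g x)\<^sup>2 \<partial>I11) + 2 * (\<integral>x. (g x - h x)\<^sup>2 \<partial>I11)"
proof -
  have int: "integrable I11 (\<lambda>x. (f x - h x)\<^sup>2)" "integrable I11 (\<lambda>x. (f x - g x)\<^sup>2)"
    "integrable I11 (\<lambda>x. (g x - h x)\<^sup>2)"
    using assms[THEN diff_in_L2] assms by (auto simp: L2_def)
  have "(\<integral>x. (f x - h x)\<^sup>2 \<partial>I11) \<le> (\<integral>x. 2 * (f x - g x)\<^sup>2 + 2 * (g x - h x)\<^sup>2 \<partial>I11)"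
  proof (intro integral_mono)
    fix x
    show "(f x - h x)\<^sup>2 \<le> 2 * (f x - g x)\<^sup>2 + 2 * (g x - h x)\<^sup>2"
      using zero_le_power2[of "(f x - g x) - (g x - h x)"] by (simp add: power2_eq_square algebra_simps)
  qed (use int in auto)
  also have "\<dots> = 2 * (\<integral>x. (f x - g x)\<^sup>2 \<partial>I11) + 2 * (\<integral>x. (g x - h x)\<^sup>2 \<partial>I11)"
    using int by simp
  finally show ?thesis .
qed

lemma finite_measure_I11: "finite_measure I11"
  by (rule finite_measureI) (simp add: emeasure_restrict_space)

lemma measure_I11: "measure I11 {-1..1} = 2"
  by (simp add: measure_restrict_space)

lemma bounded_in_L2:
  assumes "f \<in> borel_measurable I11" "\<And>x. \<bar>f x\<bar> \<le> B"
  shows "f \<in> L2"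
proof -
  interpret finite_measure I11 by (rule finite_measure_I11)
  have "(f x)\<^sup>2 \<le> B\<^sup>2" for x
    using power_mono[OF assms(2) abs_ge_zero, of x 2] by simp
  then have "integrable I11 (\<lambda>x. (f x)\<^sup>2)"
    using assms(1) by (intro integrable_const_bound[of _ "B\<^sup>2"]) auto
  then show ?thesis using assms(1) by (simp add: L2_def)
qed

definition clamp_to :: "real \<Rightarrow> real \<Rightarrow> real" where
  "clamp_to B y = max (-B) (min B y)"

lemma abs_clamp_to_le: "B \<ge> 0 \<Longrightarrow> \<bar>clamp_to B y\<bar> \<le> B"
  by (auto simp: clamp_to_def)

lemma clamp_to_ident: "\<bar>y\<bar> \<le> B \<Longrightarrow> clamp_to B y = y"
  by (auto simp: clamp_to_def)

lemma clamp_to_measurable [measurable]: "clamp_to B \<in> borel_measurable borel"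
  unfolding clamp_to_def by measurable

text \<open>
  Density is reached in three steps: truncation makes the function bounded, a measurable function
  is an almost everywhere limit of continuous ones, and Weierstrass' theorem treats continuous
  functions.  Boundedness is what provides a dominating constant in the second step.
\<close>
lemma bounded_approximable:
  assumes f: "f \<in> L2" and "\<eta> > 0"
  shows "\<exists>g B. g \<in> borel_measurable I11 \<and> (\<forall>x. \<bar>g x\<bar> \<le> B) \<and> B > 0 \<and> (\<integral>x. (f x - g x)\<^sup>2 \<partial>I11) < \<eta>"
proof -
  have [measurable]: "f \<in> borel_measurable I11" using f by (simp add: L2_def)
  have "(\<lambda>n. \<integral>x. (f x - clamp_to (real n) (f x))\<^sup>2 \<partial>I11) \<longlonglongrightarrow> (\<integral>x. 0 \<partial>I11)"
  proof (rule integral_dominated_convergence[where w = "\<lambda>x. (f x)\<^sup>2"])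
    show "integrable I11 (\<lambda>x. (f x)\<^sup>2)" using f by (simp add: L2_def)
    show "AE x in I11. (\<lambda>n. (f x - clamp_to (real n) (f x))\<^sup>2) \<longlonglongrightarrow> 0"
    proof (rule AE_I2)
      fix x
      have "eventually (\<lambda>n. (f x - clamp_to (real n) (f x))\<^sup>2 = 0) sequentially"
        using eventually_ge_at_top[of "nat \<lceil>\<bar>f x\<bar>\<rceil>"]
        by eventually_elim (simp add: clamp_to_ident nat_le_iff ceiling_le_iff)
      then show "(\<lambda>n. (f x - clamp_to (real n) (f x))\<^sup>2) \<longlonglongrightarrow> 0"
        by (rule tendsto_eventually)
    qed
    show "AE x in I11. norm ((f x - clamp_to (real n) (f x))\<^sup>2) \<le> (f x)\<^sup>2" for n
    proof (rule AE_I2)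
      fix x
      have "\<bar>f x - clamp_to (real n) (f x)\<bar> \<le> \<bar>f x\<bar>"
        by (auto simp: clamp_to_def)
      then show "norm ((f x - clamp_to (real n) (f x))\<^sup>2) \<le> (f x)\<^sup>2"
        by (simp only: abs_le_square_iff abs_power2 real_norm_def)
    qed
  qed auto
  then have "eventually (\<lambda>n. (\<integral>x. (f x - clamp_to (real n) (f x))\<^sup>2 \<partial>I11) < \<eta>) sequentially"
    using assms(2) by (intro order_tendstoD(2)) auto
  then have "eventually (\<lambda>n. (\<integral>x. (f x - clamp_to (real n) (f x))\<^sup>2 \<partial>I11) < \<eta> \<and> 0 < n) sequentially"
    using eventually_gt_at_top[of 0] by eventually_elim simp
  then obtain n where n: "(\<integral>x. (f x - clamp_to (real n) (f x))\<^sup>2 \<partial>I11) < \<eta>" "0 < n"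
    by (auto simp: eventually_sequentially)
  show ?thesis
    by (intro exI[of _ "\<lambda>x. clamp_to (real n) (f x)"] exI[of _ "real n"])
       (use n in \<open>auto simp: abs_clamp_to_le\<close>)
qed

lemma continuous_approximable:
  fixes f :: "real \<Rightarrow> real"
  assumes [measurable]: "f \<in> borel_measurable I11" and B: "\<And>x. \<bar>f x\<bar> \<le> B" "B > 0" and "\<eta> > 0"
  shows "\<exists>g. continuous_on UNIV g \<and> (\<forall>x. \<bar>g x\<bar> \<le> B) \<and> (\<integral>x. (f x - g x)\<^sup>2 \<partial>I11) < \<eta>"
proof -
  have "f measurable_on {-1..1}"
    using measurable_on_iff_borel_measurable[of "{-1..1}" f] assms(1) by simp
  then obtain Z g where Z: "negligible Z" and g: "\<And>n. continuous_on UNIV (g n)"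
    and lim: "\<And>x. x \<notin> Z \<Longrightarrow> (\<lambda>n. g n x) \<longlonglongrightarrow> (if x \<in> {-1..1} then f x else 0)"
    unfolding measurable_on_def by blast
  (* The functions g n need not be uniformly bounded; clamping them at the bound of f keeps their limit. *)
  define c where "c n x = clamp_to B (g n x)" for n x
  have cont: "continuous_on UNIV (c n)" for n
    unfolding c_def clamp_to_def by (intro continuous_intros g)
  have c_le: "\<bar>c n x\<bar> \<le> B" for n x
    unfolding c_def using B by (intro abs_clamp_to_le) auto
  have [measurable]: "c n \<in> borel_measurable I11" for n
    by (intro borel_measurable_integrable continuous_imp_integrable_real continuous_on_subset[OF cont]) auto
  have "(\<lambda>n. \<integral>x. (f x - c n x)\<^sup>2 \<partial>I11) \<longlonglongrightarrow> (\<integral>x. 0 \<partial>I11)"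
  proof (rule integral_dominated_convergence[where w = "\<lambda>x. (2 * B)\<^sup>2"])
    interpret finite_measure I11 by (rule finite_measure_I11)
    show "integrable I11 (\<lambda>x. (2 * B)\<^sup>2)" by simp
    have "AE x in lebesgue. x \<notin> Z"
      using Z by (intro AE_not_in) (simp add: negligible_iff_null_sets)
    then have "AE x in I11. x \<notin> Z"
      by (subst AE_restrict_space_iff) auto
    moreover have "AE x in I11. x \<in> {-1..1}" by (rule AE_I2) simp
    ultimately show "AE x in I11. (\<lambda>n. (f x - c n x)\<^sup>2) \<longlonglongrightarrow> 0"
    proof eventually_elim
      fix x :: real assume x: "x \<notin> Z" "x \<in> {-1..1}"
      have "(\<lambda>n. c n x) \<longlonglongrightarrow> clamp_to B (f x)"
        unfolding c_def clamp_to_def using lim[OF x(1)] x(2) by (intro tendsto_intros) simp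
      then have "(\<lambda>n. (f x - c n x)\<^sup>2) \<longlonglongrightarrow> (f x - f x)\<^sup>2"
        using B(1)[of x] by (intro tendsto_intros) (simp add: clamp_to_ident)
      then show "(\<lambda>n. (f x - c n x)\<^sup>2) \<longlonglongrightarrow> 0" by simp
    qed
    show "AE x in I11. norm ((f x - c n x)\<^sup>2) \<le> (2 * B)\<^sup>2" for n
    proof (rule AE_I2)
      fix x
      have "\<bar>f x - c n x\<bar> \<le> \<bar>2 * B\<bar>" using B(1)[of x] c_le[of n x] by linarith
      then show "norm ((f x - c n x)\<^sup>2) \<le> (2 * B)\<^sup>2" by (simp only: abs_le_square_iff abs_power2 real_norm_def)
    qed
  qed auto
  then have "eventually (\<lambda>n. (\<integral>x. (f x - c n x)\<^sup>2 \<partial>I11) < \<eta>) sequentially"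
    using assms(4) by (intro order_tendstoD(2)) auto
  then obtain n where "(\<integral>x. (f x - c n x)\<^sup>2 \<partial>I11) < \<eta>"
    by (auto simp: eventually_sequentially)
  then show ?thesis using cont c_le by blast
qed

lemma continuous_poly_approximable:
  assumes cont: "continuous_on UNIV f" and "\<eta> > 0"
  shows "\<exists>p. (\<integral>x. (f x - poly p x)\<^sup>2 \<partial>I11) < \<eta>"
proof -
  define e where "e = sqrt (\<eta> / 4)"
  have e: "e > 0" "e\<^sup>2 = \<eta> / 4" using assms(2) by (auto simp: e_def)
  obtain g where g: "real_polynomial_function g" "\<And>x. x \<in> {-1..1} \<Longrightarrow> \<bar>f x - g x\<bar> < e"
    using Stone_Weierstrass_real_polynomial_function[of "{-1..1}" f e] e
      continuous_on_subset[OF cont] by (metis compact_Icc subset_UNIV)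
  obtain a n where a: "g = (\<lambda>x. \<Sum>i\<le>n. a i * x ^ i)"
    using real_polynomial_function_imp_sum[OF g(1)] by blast
  define p where "p = (\<Sum>i\<le>n. monom (a i) i)"
  have p: "poly p x = g x" for x by (simp add: p_def a poly_sum poly_monom)
  interpret finite_measure I11 by (rule finite_measure_I11)
  have "(\<integral>x. (f x - poly p x)\<^sup>2 \<partial>I11) \<le> (\<integral>x. e\<^sup>2 \<partial>I11)"
  proof (intro integral_mono)
    show "integrable I11 (\<lambda>x. (f x - poly p x)\<^sup>2)"
      by (intro continuous_imp_integrable_real continuous_intros continuous_on_subset[OF cont]) auto
    fix x assume "x \<in> space I11"
    then have "\<bar>f x - poly p x\<bar> \<le> \<bar>e\<bar>" using g(2)[of x] p e(1) by simp
    then show "(f x - poly p x)\<^sup>2 \<le> e\<^sup>2" by (simp only: abs_le_square_iff)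
  qed simp
  also have "\<dots> = 2 * e\<^sup>2" using measure_I11 by simp
  also have "\<dots> < \<eta>" using e assms(2) by simp
  finally show ?thesis by blast
qed

lemma poly_dense_L2:
  assumes f: "f \<in> L2" and "\<eta> > 0"
  shows "\<exists>p. (\<integral>x. (f x - poly p x)\<^sup>2 \<partial>I11) < \<eta>"
proof -
  obtain g B where g: "g \<in> borel_measurable I11" "\<And>x. \<bar>g x\<bar> \<le> B" "B > 0"
    and fg: "(\<integral>x. (f x - g x)\<^sup>2 \<partial>I11) < \<eta> / 4"
    using bounded_approximable[OF f, of "\<eta> / 4"] assms(2) by auto
  obtain h where h: "continuous_on UNIV h" "\<And>x. \<bar>h x\<bar> \<le> B"
    and gh: "(\<integral>x. (g x - h x)\<^sup>2 \<partial>I11) < \<eta> / 16"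
    using continuous_approximable[OF g, of "\<eta> / 16"] assms(2) by auto
  obtain p where hp: "(\<integral>x. (h x - poly p x)\<^sup>2 \<partial>I11) < \<eta> / 16"
    using continuous_poly_approximable[OF h(1), of "\<eta> / 16"] assms(2) by auto
  have gL2: "g \<in> L2" using g by (intro bounded_in_L2)
  have "h \<in> borel_measurable I11"
    by (intro borel_measurable_integrable continuous_imp_integrable_real continuous_on_subset[OF h(1)]) auto
  then have hL2: "h \<in> L2" using h(2) by (rule bounded_in_L2)
  (* Each triangle step doubles the squared distances: 2 (1/16 + 1/16) = 1/4 and 2 (1/4 + 1/4) = 1. *)
  have "(\<integral>x. (g x - poly p x)\<^sup>2 \<partial>I11) < \<eta> / 4"
    using integral_diff_square_triangle[OF gL2 hL2 poly_in_L2[of p]] gh hp by linarith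
  then have "(\<integral>x. (f x - poly p x)\<^sup>2 \<partial>I11) < \<eta>"
    using integral_diff_square_triangle[OF f gL2 poly_in_L2[of p]] fg by linarith
  then show ?thesis by blast
qed

section \<open>Bias and variance\<close>

text \<open>
  Half of Parseval's identity suffices: a polynomial p that approximates f up to \<eta> lies in the
  span of P_0, ..., P_n for some n, so at most \<eta> of the energy of f lies beyond n.  Between N
  and n every weight k^(2r) is at least (N + 1)^(2r).
\<close>
lemma legendre_tail_le:
  assumes f: "f \<in> sobolev_class r L" and "r > 0"
  shows "(\<integral>x. (f x)\<^sup>2 \<partial>I11) - (\<Sum>k\<le>N. (legendre_coeff f k)\<^sup>2) \<le> L * real (N + 1) powr (- 2 * r)"
proof (rule field_le_epsilon)
  fix \<eta> :: real assume "\<eta> > 0"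
  define \<theta> where "\<theta> = legendre_coeff f"
  define w where "w k = real k powr (2 * r)" for k
  have fL2: "f \<in> L2" and summ: "summable (\<lambda>k. w k * (\<theta> k)\<^sup>2)" and total: "(\<Sum>k. w k * (\<theta> k)\<^sup>2) \<le> L"
    using f by (auto simp: sobolev_class_def sobolev_def \<theta>_def w_def)
  obtain p where p: "(\<integral>x. (f x - poly p x)\<^sup>2 \<partial>I11) < \<eta>"
    using poly_dense_L2[OF fL2 \<open>\<eta> > 0\<close>] by blast
  define n where "n = max N (degree p)"
  obtain a where a: "p = (\<Sum>k\<le>n. smult (a k) (legendre k))"
    using poly_eq_sum_legendre[of p n] by (auto simp: n_def)
  have "(\<integral>x. (f x)\<^sup>2 \<partial>I11) - (\<Sum>k\<le>n. (\<theta> k)\<^sup>2)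
      \<le> (\<integral>x. ((\<Sum>k\<le>n. a k * poly (legendre k) x) - f x)\<^sup>2 \<partial>I11)"
    unfolding integral_legendre_sum_diff_square[OF fL2] by (simp add: \<theta>_def sum_nonneg)
  also have "\<dots> = (\<integral>x. (f x - poly p x)\<^sup>2 \<partial>I11)"
    by (simp add: a poly_sum power2_commute)
  finally have "(\<integral>x. (f x)\<^sup>2 \<partial>I11) - (\<Sum>k\<le>n. (\<theta> k)\<^sup>2) \<le> \<eta>"
    using p by simp
  moreover have "(\<Sum>k\<le>n. (\<theta> k)\<^sup>2) = (\<Sum>k\<le>N. (\<theta> k)\<^sup>2) + (\<Sum>k\<in>{N<..n}. (\<theta> k)\<^sup>2)"
    by (subst sum.union_disjoint[symmetric]) (auto simp: n_def intro!: sum.cong)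
  moreover have "(\<Sum>k\<in>{N<..n}. (\<theta> k)\<^sup>2) \<le> L * real (N + 1) powr (- 2 * r)"
  proof -
    have "(\<Sum>k\<in>{N<..n}. (\<theta> k)\<^sup>2) \<le> (\<Sum>k\<in>{N<..n}. (w k * (\<theta> k)\<^sup>2) * real (N + 1) powr (- 2 * r))"
    proof (intro sum_mono)
      fix k assume "k \<in> {N<..n}"
      then have "real (N + 1) powr (2 * r) \<le> w k"
        unfolding w_def using assms(2) by (intro powr_mono2) auto
      then have "1 \<le> w k * real (N + 1) powr (- 2 * r)"
        by (simp add: powr_minus field_simps)
      from mult_left_mono[OF this, of "(\<theta> k)\<^sup>2"]
      show "(\<theta> k)\<^sup>2 \<le> (w k * (\<theta> k)\<^sup>2) * real (N + 1) powr (- 2 * r)"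
        by (simp add: mult_ac)
    qed
    also have "\<dots> = (\<Sum>k\<in>{N<..n}. w k * (\<theta> k)\<^sup>2) * real (N + 1) powr (- 2 * r)"
      by (rule sum_distrib_right[symmetric])
    also have "\<dots> \<le> L * real (N + 1) powr (- 2 * r)"
    proof (intro mult_right_mono)
      have "(\<Sum>k\<in>{N<..n}. w k * (\<theta> k)\<^sup>2) \<le> (\<Sum>k. w k * (\<theta> k)\<^sup>2)"
        by (intro sum_le_suminf summ) (auto simp: w_def)
      then show "(\<Sum>k\<in>{N<..n}. w k * (\<theta> k)\<^sup>2) \<le> L" using total by linarith
    qed simp
    finally show ?thesis .
  qed
  ultimately show "(\<integral>x. (f x)\<^sup>2 \<partial>I11) - (\<Sum>k\<le>N. (legendre_coeff f k)\<^sup>2)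
      \<le> L * real (N + 1) powr (- 2 * r) + \<eta>"
    unfolding \<theta>_def by linarith
qed

lemma L2norm_estimator_error_square:
  assumes "f \<in> L2"
  shows "(L2norm (\<lambda>x. legendre_estimator N (noisy_moment f \<epsilon> \<xi> \<omega>) x - f x))\<^sup>2
           = ((\<integral>x. (f x)\<^sup>2 \<partial>I11) - (\<Sum>k\<le>N. (legendre_coeff f k)\<^sup>2))
             + \<epsilon>\<^sup>2 * (\<Sum>k\<le>N. (\<Sum>j\<le>k. coeff (legendre k) j * \<xi> j \<omega>)\<^sup>2)"
proof -
  define Z where "Z k = (\<Sum>j\<le>k. coeff (legendre k) j * \<xi> j \<omega>)" for k
  have "legendre_estimator N (noisy_moment f \<epsilon> \<xi> \<omega>) x
      = (\<Sum>k\<le>N. (legendre_coeff f k + \<epsilon> * Z k) * poly (legendre k) x)" for x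
    unfolding legendre_estimator_def legendre_coeff_eq_sum_moments[OF assms] Z_def
    by (simp add: noisy_moment_def sum_distrib_left sum_distrib_right sum.distrib[symmetric] algebra_simps)
  then have "(L2norm (\<lambda>x. legendre_estimator N (noisy_moment f \<epsilon> \<xi> \<omega>) x - f x))\<^sup>2
      = (\<integral>x. ((\<Sum>k\<le>N. (legendre_coeff f k + \<epsilon> * Z k) * poly (legendre k) x) - f x)\<^sup>2 \<partial>I11)"
    by (simp add: L2norm_def)
  also have "\<dots> = ((\<integral>x. (f x)\<^sup>2 \<partial>I11) - (\<Sum>k\<le>N. (legendre_coeff f k)\<^sup>2)) + \<epsilon>\<^sup>2 * (\<Sum>k\<le>N. (Z k)\<^sup>2)"
    unfolding integral_legendre_sum_diff_square[OF assms]
    by (simp add: power_mult_distrib sum_distrib_left)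
  finally show ?thesis by (simp add: Z_def)
qed

lemma nn_integral_std_normal_square:
  assumes "distributed M lborel X std_normal_density"
  shows "(\<integral>\<^sup>+\<omega>. ennreal ((X \<omega>)\<^sup>2) \<partial>M) = 1"
proof -
  have "(\<integral>\<^sup>+\<omega>. ennreal ((X \<omega>)\<^sup>2) \<partial>M) = (\<integral>\<^sup>+x. ennreal (std_normal_density x) * ennreal (x\<^sup>2) \<partial>lborel)"
    using assms by (intro distributed_nn_integral[symmetric]) auto
  also have "\<dots> = (\<integral>\<^sup>+x. ennreal (std_normal_density x * x ^ (2 * 1)) \<partial>lborel)"
    by (simp add: ennreal_mult'')
  also have "\<dots> = ennreal (\<integral>x. std_normal_density x * x ^ (2 * 1) \<partial>lborel)"
    by (intro nn_integral_eq_integral integrable_std_normal_moment) auto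
  also have "\<dots> = 1"
    unfolding integral_std_normal_moment_even by simp
  finally show ?thesis .
qed

text \<open>
  The noise enters only through combinations of \<xi>_0, ..., \<xi>_N whose weights are Legendre
  coefficients.  The Cauchy-Schwarz inequality bounds their squares pointwise by the squared
  weights times the sum of the \<xi>_j^2, whose expectation is N + 1; the polynomial factor lost
  here is harmless because the exponential decay of the variance has room to spare.
\<close>
lemma risk_le:
  assumes f: "f \<in> sobolev_class r L" and "r > 0" and "L > 0"
    and \<xi>: "iid_std_normal M \<xi>"
  shows "risk M \<xi> \<epsilon> N f
    \<le> ennreal (L * real (N + 1) powr (- 2 * r) + \<epsilon>\<^sup>2 * (real (N + 1) ^ 3 * (1 + sqrt 2) ^ (2 * N)))"
proof -
  interpret prob_space M using \<xi> by (simp add: iid_std_normal_def)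
  have dist: "distributed M lborel (\<xi> j) std_normal_density" for j
    using \<xi> by (simp add: iid_std_normal_def)
  have [measurable]: "\<xi> j \<in> borel_measurable M" for j
    using distributed_measurable[OF dist[of j]] by simp
  have fL2: "f \<in> L2" using f by (simp add: sobolev_class_def sobolev_def)
  define A where "A = L * real (N + 1) powr (- 2 * r)"
  define V where "V = real (N + 1) * (1 + sqrt 2) ^ (2 * N)"
  have A: "A \<ge> 0" using assms by (simp add: A_def)
  have V: "V \<ge> 0" by (simp add: V_def)
  have pointwise: "(L2norm (\<lambda>x. legendre_estimator N (noisy_moment f \<epsilon> \<xi> \<omega>) x - f x))\<^sup>2
      \<le> A + \<epsilon>\<^sup>2 * (real (N + 1) * V) * (\<Sum>j\<le>N. (\<xi> j \<omega>)\<^sup>2)" for \<omega>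
  proof -
    have "(\<Sum>j\<le>k. coeff (legendre k) j * \<xi> j \<omega>)\<^sup>2 \<le> V * (\<Sum>j\<le>N. (\<xi> j \<omega>)\<^sup>2)" if "k \<le> N" for k
    proof -
      have "(\<Sum>j\<le>k. coeff (legendre k) j * \<xi> j \<omega>)\<^sup>2
          \<le> (\<Sum>j\<le>k. (coeff (legendre k) j)\<^sup>2) * (\<Sum>j\<le>k. (\<xi> j \<omega>)\<^sup>2)"
        by (rule Cauchy_Schwarz_ineq_sum)
      also have "\<dots> \<le> V * (\<Sum>j\<le>N. (\<xi> j \<omega>)\<^sup>2)"
      proof (intro mult_mono)
        have "real (k + 1) * (1 + sqrt 2) ^ (2 * k) \<le> V"
          unfolding V_def using that by (intro mult_mono power_increasing) auto
        then show "(\<Sum>j\<le>k. (coeff (legendre k) j)\<^sup>2) \<le> V"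
          using sum_coeff_legendre_sq_le[of k] by linarith
        show "(\<Sum>j\<le>k. (\<xi> j \<omega>)\<^sup>2) \<le> (\<Sum>j\<le>N. (\<xi> j \<omega>)\<^sup>2)"
          using that by (intro sum_mono2) auto
      qed (auto simp: V sum_nonneg)
      finally show ?thesis .
    qed
    then have "(\<Sum>k\<le>N. (\<Sum>j\<le>k. coeff (legendre k) j * \<xi> j \<omega>)\<^sup>2) \<le> (\<Sum>k\<le>N. V * (\<Sum>j\<le>N. (\<xi> j \<omega>)\<^sup>2))"
      by (intro sum_mono) auto
    then have "\<epsilon>\<^sup>2 * (\<Sum>k\<le>N. (\<Sum>j\<le>k. coeff (legendre k) j * \<xi> j \<omega>)\<^sup>2)
        \<le> \<epsilon>\<^sup>2 * (real (N + 1) * V) * (\<Sum>j\<le>N. (\<xi> j \<omega>)\<^sup>2)"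
      by (simp add: mult_left_mono mult.assoc add.commute)
    then show ?thesis
      unfolding L2norm_estimator_error_square[OF fL2]
      using legendre_tail_le[OF f \<open>r > 0\<close>, of N] unfolding A_def by linarith
  qed
  have "risk M \<xi> \<epsilon> N f
      \<le> (\<integral>\<^sup>+\<omega>. ennreal (A + \<epsilon>\<^sup>2 * (real (N + 1) * V) * (\<Sum>j\<le>N. (\<xi> j \<omega>)\<^sup>2)) \<partial>M)"
    unfolding risk_def by (intro nn_integral_mono ennreal_leI pointwise)
  also have "\<dots> = (\<integral>\<^sup>+\<omega>. ennreal A + ennreal (\<epsilon>\<^sup>2 * (real (N + 1) * V)) * (\<Sum>j\<le>N. ennreal ((\<xi> j \<omega>)\<^sup>2)) \<partial>M)"
    using A V by (intro nn_integral_cong) (simp add: ennreal_plus ennreal_mult sum_nonneg del: of_nat_add)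
  also have "\<dots> = ennreal A + ennreal (\<epsilon>\<^sup>2 * (real (N + 1) * V)) * (\<Sum>j\<le>N. \<integral>\<^sup>+\<omega>. ennreal ((\<xi> j \<omega>)\<^sup>2) \<partial>M)"
    by (simp add: nn_integral_add nn_integral_cmult nn_integral_sum emeasure_space_1 del: of_nat_add sum_ennreal)
  also have "\<dots> = ennreal A + ennreal (\<epsilon>\<^sup>2 * (real (N + 1) * V)) * ennreal (real (N + 1))"
    by (simp add: nn_integral_std_normal_square[OF dist] ennreal_of_nat_eq_real_of_nat del: of_nat_add)
  also have "\<dots> = ennreal (A + \<epsilon>\<^sup>2 * (real (N + 1) * V) * real (N + 1))"
    using A V by (simp add: ennreal_plus ennreal_mult del: of_nat_add)
  also have "A + \<epsilon>\<^sup>2 * (real (N + 1) * V) * real (N + 1)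
      = L * real (N + 1) powr (- 2 * r) + \<epsilon>\<^sup>2 * (real (N + 1) ^ 3 * (1 + sqrt 2) ^ (2 * N))"
    by (simp add: A_def V_def power3_eq_cube del: of_nat_add)
  finally show ?thesis .
qed

section \<open>The rate along the logarithmic cutoff\<close>

lemma powr_le_exp:
  fixes a c :: real
  assumes "a > 0" "c > 0"
  shows "\<exists>K>0. \<forall>T>0. T powr a \<le> K * exp (c * T)"
proof (intro exI[of _ "(a / c) powr a"] conjI allI impI)
  fix T :: real assume "T > 0"
  have "c / a * T \<le> exp (c / a * T)"
    using exp_ge_add_one_self[of "c / a * T"] by linarith
  then have "(c / a * T) powr a \<le> exp (c / a * T) powr a"
    using assms \<open>T > 0\<close> by (intro powr_mono2) auto
  also have "\<dots> = exp (c * T)"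
    using assms by (simp add: powr_def)
  finally have "(a / c) powr a * (c / a * T) powr a \<le> (a / c) powr a * exp (c * T)"
    by (intro mult_left_mono) auto
  moreover have "(a / c) powr a * (c / a * T) powr a = T powr a"
    using assms \<open>T > 0\<close> by (subst powr_mult[symmetric]) auto
  ultimately show "T powr a \<le> (a / c) powr a * exp (c * T)" by simp
qed (use assms in auto)

text \<open>
  With T = ln (1 / \<epsilon>) the exponential factors combine to exp (-2 \<delta> T), where
  \<delta> = 1 - \<alpha> ln (1 + sqrt 2) is positive by the assumption on \<alpha>.  Half of this decay pays for
  the cubic factor, in equal shares for its three linear factors, and the other half for T^(2r).
\<close>
lemma variance_le_powr:
  fixes r \<alpha> :: real
  assumes "r > 0" "\<alpha> > 0" "\<alpha> < 1 / ln (1 + sqrt 2)"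
  shows "\<exists>K>0. \<forall>\<epsilon>. 0 < \<epsilon> \<and> \<epsilon> < 1 \<longrightarrow>
           \<epsilon>\<^sup>2 * (real (cutoff \<alpha> \<epsilon> + 1) ^ 3 * (1 + sqrt 2) ^ (2 * cutoff \<alpha> \<epsilon>))
             \<le> K * ln (1 / \<epsilon>) powr (- 2 * r)"
proof -
  define l where "l = ln (1 + sqrt 2)"
  define \<delta> where "\<delta> = 1 - \<alpha> * l"
  have l: "l > 0" unfolding l_def by (intro ln_gt_zero) simp
  have \<delta>: "\<delta> > 0" using assms(3) l by (simp add: \<delta>_def field_simps flip: l_def)
  obtain K where K: "K > 0" "\<And>T. T > 0 \<Longrightarrow> T powr (2 * r) \<le> K * exp (\<delta> * T)"
    using powr_le_exp[of "2 * r" \<delta>] assms(1) \<delta> by auto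
  define K' where "K' = 3 * \<alpha> / \<delta> + 1"
  have K': "K' > 0" using assms \<delta> by (simp add: K'_def add_pos_pos)
  have main: "\<epsilon>\<^sup>2 * (real (cutoff \<alpha> \<epsilon> + 1) ^ 3 * (1 + sqrt 2) ^ (2 * cutoff \<alpha> \<epsilon>))
             \<le> K' ^ 3 * K * ln (1 / \<epsilon>) powr (- 2 * r)" if \<epsilon>: "0 < \<epsilon>" "\<epsilon> < 1" for \<epsilon>
  proof -
    define T where "T = ln (1 / \<epsilon>)"
    define N where "N = cutoff \<alpha> \<epsilon>"
    have T: "T > 0" using \<epsilon> by (simp add: T_def)
    have N: "real N \<le> \<alpha> * T"
      using T assms(2) by (simp add: N_def cutoff_def flip: T_def)
    have "\<alpha> * T \<le> 3 * \<alpha> / \<delta> * exp (\<delta> * T / 3)"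
    proof -
      have "\<delta> * T / 3 \<le> exp (\<delta> * T / 3)"
        using exp_ge_add_one_self[of "\<delta> * T / 3"] by linarith
      then have "3 * \<alpha> / \<delta> * (\<delta> * T / 3) \<le> 3 * \<alpha> / \<delta> * exp (\<delta> * T / 3)"
        using assms(2) \<delta> by (intro mult_left_mono) auto
      then show ?thesis using \<delta> by simp
    qed
    moreover have "1 \<le> exp (\<delta> * T / 3)" using \<delta> T by simp
    moreover have "K' * exp (\<delta> * T / 3) = 3 * \<alpha> / \<delta> * exp (\<delta> * T / 3) + exp (\<delta> * T / 3)"
      by (simp add: K'_def distrib_right)
    ultimately have "real (N + 1) \<le> K' * exp (\<delta> * T / 3)"
      using N by linarith
    then have "real (N + 1) ^ 3 \<le> (K' * exp (\<delta> * T / 3)) ^ 3"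
      by (intro power_mono) auto
    also have "\<dots> = K' ^ 3 * exp (\<delta> * T)"
      by (simp add: power_mult_distrib flip: exp_of_nat_mult)
    finally have cubic: "real (N + 1) ^ 3 \<le> K' ^ 3 * exp (\<delta> * T)" .
    have "exp l = 1 + sqrt 2"
      unfolding l_def by (intro exp_ln add_pos_pos) auto
    then have "(1 + sqrt 2) ^ (2 * N) = exp (l * (2 * real N))"
      using exp_of_nat_mult[of "2 * N" l] by (simp add: mult.commute)
    also have "\<dots> \<le> exp (l * (2 * (\<alpha> * T)))"
      using N l by simp
    finally have geometric: "(1 + sqrt 2) ^ (2 * N) \<le> exp (l * (2 * (\<alpha> * T)))" .
    have "\<epsilon> = exp (- T)" using \<epsilon> by (simp add: T_def ln_div)
    then have \<epsilon>2: "\<epsilon>\<^sup>2 = exp (- (2 * T))" by (simp flip: exp_double)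
    have "1 \<le> K * exp (\<delta> * T) * T powr (- 2 * r)"
      using K(2)[OF T] T by (simp add: powr_minus field_simps)
    then have decay: "exp (- (\<delta> * T)) \<le> K * T powr (- 2 * r)"
      by (simp add: exp_minus field_simps)
    have "\<epsilon>\<^sup>2 * (real (N + 1) ^ 3 * (1 + sqrt 2) ^ (2 * N))
        \<le> exp (- (2 * T)) * (K' ^ 3 * exp (\<delta> * T) * exp (l * (2 * (\<alpha> * T))))"
      unfolding \<epsilon>2 using K' by (intro mult_left_mono mult_mono cubic geometric) auto
    also have "\<dots> = K' ^ 3 * exp (- (\<delta> * T))"
      by (simp add: \<delta>_def algebra_simps flip: exp_add)
    also have "\<dots> \<le> K' ^ 3 * (K * T powr (- 2 * r))"
      using K' by (intro mult_left_mono decay) auto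
    finally show ?thesis by (simp add: N_def T_def mult.assoc)
  qed
  then show ?thesis using K K' by (intro exI[of _ "K' ^ 3 * K"]) auto
qed

theorem theorem1:
  fixes r \<alpha> L :: real
  assumes "r > 0"
    and "\<alpha> > 0" and "\<alpha> < 1 / ln (1 + sqrt 2)"
    and "L > 0"
  shows "\<exists>C>0. \<forall>(M :: 'w measure) \<xi>. iid_std_normal M \<xi> \<longrightarrow>
           (\<forall>\<epsilon>. 0 < \<epsilon> \<and> \<epsilon> < 1 \<longrightarrow>
              (SUP f\<in>sobolev_class r L. risk M \<xi> \<epsilon> (cutoff \<alpha> \<epsilon>) f)
                \<le> ennreal (C * ln (1 / \<epsilon>) powr (- 2 * r)))"
proof -
  obtain K where K: "K > 0" "\<And>\<epsilon>. 0 < \<epsilon> \<Longrightarrow> \<epsilon> < 1 \<Longrightarrow>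
      \<epsilon>\<^sup>2 * (real (cutoff \<alpha> \<epsilon> + 1) ^ 3 * (1 + sqrt 2) ^ (2 * cutoff \<alpha> \<epsilon>)) \<le> K * ln (1 / \<epsilon>) powr (- 2 * r)"
    using variance_le_powr[OF assms(1-3)] by blast
  define C where "C = L * \<alpha> powr (- 2 * r) + K"
  show ?thesis
  proof (intro exI[of _ C] conjI allI impI)
    show "C > 0" using K(1) assms(2,4) by (simp add: C_def add_pos_pos)
    fix M :: "'w measure" and \<xi> and \<epsilon> :: real
    assume \<xi>: "iid_std_normal M \<xi>" and "0 < \<epsilon> \<and> \<epsilon> < 1"
    then have \<epsilon>: "0 < \<epsilon>" "\<epsilon> < 1" by auto
    define T where "T = ln (1 / \<epsilon>)"
    define N where "N = cutoff \<alpha> \<epsilon>"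
    have T: "T > 0" using \<epsilon> by (simp add: T_def)
    have "\<alpha> * T \<le> real (N + 1)"
      unfolding N_def cutoff_def T_def[symmetric] by linarith
    then have "real (N + 1) powr (- 2 * r) \<le> (\<alpha> * T) powr (- 2 * r)"
      using T assms(1,2) by (intro powr_mono2') auto
    also have "\<dots> = \<alpha> powr (- 2 * r) * T powr (- 2 * r)"
      using T assms(2) by (simp add: powr_mult)
    finally have "L * real (N + 1) powr (- 2 * r) \<le> L * (\<alpha> powr (- 2 * r) * T powr (- 2 * r))"
      using assms(4) by (intro mult_left_mono) auto
    then have "L * real (N + 1) powr (- 2 * r) + \<epsilon>\<^sup>2 * (real (N + 1) ^ 3 * (1 + sqrt 2) ^ (2 * N))
        \<le> C * T powr (- 2 * r)"
      using K(2)[OF \<epsilon>] by (simp add: C_def N_def T_def algebra_simps del: of_nat_add)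
    then have "risk M \<xi> \<epsilon> N f \<le> ennreal (C * T powr (- 2 * r))" if "f \<in> sobolev_class r L" for f
      using risk_le[OF that assms(1,4) \<xi>, of \<epsilon> N] by (meson ennreal_leI order_trans)
    then show "(SUP f\<in>sobolev_class r L. risk M \<xi> \<epsilon> (cutoff \<alpha> \<epsilon>) f) \<le> ennreal (C * ln (1 / \<epsilon>) powr (- 2 * r))"
      by (auto intro!: SUP_least simp: N_def T_def)
  qed
qed

end
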